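(* For every integer $n\geqslant 0$ the following hold. (i) $\displaystyle \sum_{k=0}^\infty (-1)^{k(k+1)/2}\, Q_0\big(n-k(k+1)/2\big) = \xi_n$. (ii) $\displaystyle \sum_{k=0}^\infty (-1)^{k(k+1)/2}\, Q_2\big(n-k(k+1)/2\big) = \chi_n$.
   Context: A partition of $n$ is a nonincreasing sequence of positive integers (called parts) with sum $n$; the empty partition is the only partition of $0$. For $k\in\{0,2\}$, $Q_k(n)$ is the number of partitions of $n$ into distinct parts none of which is congruent to $k$ modulo $4$; $Q_k(0)=1$ and $Q_k(x)=0$ if $x$ is not a nonnegative integer (so the sums are finite). Define $$\xi_n = \begin{cases} (-1)^{m}\cdot 2 & \text{if } n=4m^2 \text{ for some integer } m>0,\\ 1 & \text{if } n=0,\\ 0 & \text{otherwise,}\end{cases}$$ and $$\chi_n = \begin{cases} (-1)^{n/2} & \text{if } n=m(m+1) \text{ for some integer } m\geqslant 0,\\ 0 & \text{otherwise.}\end{cases}$$ *)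

theory Defs
  imports Complex_Main "HOL-Number_Theory.Cong"
begin

definition is_partition :: "nat \<Rightarrow> nat list \<Rightarrow> bool" where
  "is_partition n ps \<longleftrightarrow> sorted_wrt (\<ge>) ps \<and> (\<forall>p\<in>set ps. p > 0) \<and> sum_list ps = n"

text \<open>The argument \<open>x\<close> is an integer because the sums also involve negative arguments,
  where the value is 0.\<close>

definition Q :: "nat \<Rightarrow> int \<Rightarrow> nat" where
  "Q k x = (if x < 0 then 0
            else card {ps. is_partition (nat x) ps \<and> distinct ps \<and> (\<forall>p\<in>set ps. \<not> [p = k] (mod 4))})"

definition xi :: "nat \<Rightarrow> int" where
  "xi n = (if \<exists>m::nat. m > 0 \<and> n = 4 * m\<^sup>2
             then (-1) ^ (THE m::nat. m > 0 \<and> n = 4 * m\<^sup>2) * 2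
           else if n = 0 then 1
           else 0)"

text \<open>The division by 2 is exact, since \<open>m * (m + 1)\<close> is even.\<close>

definition chi :: "nat \<Rightarrow> int" where
  "chi n = (if \<exists>m::nat. n = m * (m + 1) then (-1) ^ (n div 2) else 0)"

end

theory Submission
  imports Defs "HOL-Computational_Algebra.Polynomial"
begin

text \<open>
  Write \<open>(a; b)\<close> for the infinite product of all \<open>1 - a b\<^sup>k\<close>, \<open>k \<ge> 0\<close>, and \<open>T\<^sub>s = s (s + 1) / 2\<close>.
  The left-hand sides are the coefficients of \<open>\<psi>(-q) G\<^sub>r(q)\<close>, where \<open>\<psi>(q) = \<Sum>\<^sub>s q\<^bsup>T\<^sub>s\<^esup>\<close> and the
  generating functions of the partition numbers are
  \<open>G\<^sub>0 = (-q; q\<^sup>2) (-q\<^sup>2; q\<^sup>4)\<close> and \<open>G\<^sub>2 = (-q; q\<^sup>2) (-q\<^sup>4; q\<^sup>4)\<close>. Three classical facts suffice: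

    \<^item> Gauss on triangular numbers: \<open>(-q; q\<^sup>2) \<psi>(-q) = (q\<^sup>2; q\<^sup>2)\<close>;
    \<^item> Gauss on squares: \<open>(-q; q) \<phi>(-q) = (q; q)\<close> for \<open>\<phi>(-q) = 1 + 2 \<Sum>\<^sub>s\<^sub>\<ge>\<^sub>1 (-1)\<^sup>s q\<^bsup>s s\<^esup>\<close>;
    \<^item> Euler on odd and distinct parts: \<open>(q; q\<^sup>2) (-q; q) = 1\<close>.

  With \<open>x = q\<^sup>2\<close>, the first fact turns the two products into \<open>(x; x) (-x; x\<^sup>2)\<close> and
  \<open>(x; x) (-x\<^sup>2; x\<^sup>2)\<close>. Since \<open>(x; x) = (x; x\<^sup>2) (x\<^sup>2; x\<^sup>2)\<close> and \<open>(x; x\<^sup>2) (-x; x\<^sup>2) = (x\<^sup>2; x\<^sup>4)\<close>,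
  the former is \<open>(x\<^sup>2; x\<^sup>2) (x\<^sup>2; x\<^sup>4)\<close>, which is \<open>\<phi>(-x\<^sup>2)\<close> by Gauss on squares and Euler. In
  the latter, \<open>(x\<^sup>2; x\<^sup>2) = (-x; x\<^sup>2) \<psi>(-x)\<close> by Gauss on triangular numbers, and what remains
  besides \<open>\<psi>(-x)\<close> is \<open>(x\<^sup>2; x\<^sup>4) (-x\<^sup>2; x\<^sup>2) = 1\<close>. The coefficients of \<open>\<phi>(-q\<^sup>4)\<close> and \<open>\<psi>(-q\<^sup>2)\<close>
  are \<open>\<xi>\<close> and \<open>\<chi>\<close>.

  No infinite product and no division occurs below: every factor is a finite product in a
  commutative ring, and an identity is a congruence modulo a power of \<open>q\<close>. Both theorems of
  Gauss come from one finite sum \<open>tail_sum\<close>, after D. Shanks. A telescoping recurrence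
  (\<open>tail_sum_Suc\<close>) gives its exact value as a product times a truncated theta series, and to
  high order it agrees with its first summand, which is a product.
\<close>

section \<open>Congruences in a commutative ring\<close>

definition cong_mod :: "'a::comm_ring_1 \<Rightarrow> 'a \<Rightarrow> 'a \<Rightarrow> bool" where
  "cong_mod M f g \<longleftrightarrow> M dvd f - g"

lemma cong_mod_refl [simp]: "cong_mod M f f"
  by (simp add: cong_mod_def)

lemma cong_mod_sym: "cong_mod M f g \<Longrightarrow> cong_mod M g f"
  unfolding cong_mod_def by (metis dvd_minus_iff minus_diff_eq)

lemma cong_mod_trans [trans]: "cong_mod M f g \<Longrightarrow> cong_mod M g h \<Longrightarrow> cong_mod M f h"
  unfolding cong_mod_def using dvd_add[of M "f - g" "g - h"] by simp

lemma cong_mod_mult: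
  assumes "cong_mod M f f'" "cong_mod M g g'"
  shows "cong_mod M (f * g) (f' * g')"
proof -
  have "f * g - f' * g' = (f - f') * g + f' * (g - g')"
    by (simp add: algebra_simps)
  then show ?thesis
    using assms by (simp add: cong_mod_def)
qed

lemma cong_mod_weaken: "cong_mod M f g \<Longrightarrow> M' dvd M \<Longrightarrow> cong_mod M' f g"
  unfolding cong_mod_def by (rule dvd_trans)

section \<open>Finite q-products and finite theta identities\<close>

text \<open>The $q$-Pochhammer symbol, with base \<open>b\<close>.\<close>

definition qpoch :: "'a::comm_ring_1 \<Rightarrow> 'a \<Rightarrow> nat \<Rightarrow> 'a" where
  "qpoch a b n = (\<Prod>k<n. 1 - a * b ^ k)"

lemma qpoch_0 [simp]: "qpoch a b 0 = 1"
  by (simp add: qpoch_def)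

lemma qpoch_Suc: "qpoch a b (Suc n) = qpoch a b n * (1 - a * b ^ n)"
  by (simp add: qpoch_def)

lemma qpoch_Suc_shift: "qpoch a b (Suc n) = (1 - a) * qpoch (a * b) b n"
  unfolding qpoch_def by (subst prod.lessThan_Suc_shift) (simp add: mult_ac)

text \<open>Factorwise \<open>(1 - u) (1 + u) = 1 - u\<^sup>2\<close>.\<close>

lemma qpoch_mult_uminus: "qpoch a b n * qpoch (- a) b n = qpoch (a\<^sup>2) (b\<^sup>2) n"
  unfolding qpoch_def prod.distrib[symmetric]
  by (intro prod.cong refl) (simp add: algebra_simps power2_eq_square power_mult_distrib)

text \<open>The factors with even and with odd exponent are collected separately.\<close>

lemma qpoch_double: "qpoch a b (2 * n) = qpoch a (b\<^sup>2) n * qpoch (a * b) (b\<^sup>2) n"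
  by (induction n) (simp_all add: qpoch_Suc mult_ac flip: power_mult)

lemma qpoch_cong_1:
  assumes "M dvd a"
  shows "cong_mod M (qpoch a b n) 1"
proof (induction n)
  case (Suc n)
  have "cong_mod M (1 - a * b ^ n) 1"
    using assms by (simp add: cong_mod_def)
  from cong_mod_mult[OF Suc this] show ?case
    by (simp add: qpoch_Suc)
qed simp

text \<open>The parameters \<open>d\<close> and \<open>e\<close> leave room for both theta series: \<open>d = e = q\<close>, \<open>b = q\<^sup>2\<close> produces
  triangular numbers, and \<open>d = -q\<close>, \<open>e = -1\<close>, \<open>b = q\<close> produces squares. The first factor is the
  quotient of \<open>qpoch b b n\<close> by \<open>qpoch b b s\<close>, written without division.\<close>

definition tail_sum :: "'a::comm_ring_1 \<Rightarrow> 'a \<Rightarrow> 'a \<Rightarrow> nat \<Rightarrow> 'a" where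
  "tail_sum d e b n = (\<Sum>s\<le>n. qpoch (b ^ Suc s) b (n - s) * qpoch e b s * (d * b ^ n) ^ s)"

text \<open>The difference between the summands of \<open>tail_sum d e b (Suc n)\<close> and \<open>1 - d b\<^sup>n\<close> times those of
  \<open>tail_sum d e b n\<close> is an exact difference in \<open>s\<close>; this is where \<open>d e = b\<close> enters. What survives
  is the last summand and the upper end of the telescope, and they differ by the factor
  \<open>b ^ Suc n\<close>.\<close>

lemma tail_sum_Suc:
  fixes b d e :: "'a::comm_ring_1"
  assumes de: "d * e = b"
  shows "tail_sum d e b (Suc n) =
           (1 - d * b ^ n) * tail_sum d e b n +
           qpoch e b (Suc n) * (d * b ^ n) ^ Suc n * (1 + b ^ Suc n)"
proof -
  define t where "t n s = qpoch (b ^ Suc s) b (n - s) * qpoch e b s * (d * b ^ n) ^ s" for n s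
  \<comment> \<open>The antidifference: \<open>(1 - b ^ s) * t n s\<close> for \<open>s \<le> n\<close>, in a form that also makes sense at \<open>Suc n\<close>.\<close>
  define u where "u s = qpoch (b ^ s) b (Suc n - s) * qpoch e b s * (d * b ^ n) ^ s" for s
  have step: "t (Suc n) s - (1 - d * b ^ n) * t n s = u (Suc s) - u s" if "s \<le> n" for s
  proof -
    have 1: "t (Suc n) s = (1 - b ^ Suc n) * b ^ s * t n s"
    proof -
      have "qpoch (b ^ Suc s) b (Suc n - s) = qpoch (b ^ Suc s) b (n - s) * (1 - b ^ Suc n)"
        using that by (simp add: Suc_diff_le qpoch_Suc mult.assoc flip: power_add)
      then show ?thesis
        by (simp add: t_def power_mult_distrib mult_ac)
    qed
    have 2: "u s = (1 - b ^ s) * t n s"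
      using that by (simp add: u_def t_def Suc_diff_le qpoch_Suc_shift mult_ac)
    have 3: "u (Suc s) = (d * b ^ n - b ^ Suc n * b ^ s) * t n s"
      by (simp add: u_def t_def qpoch_Suc algebra_simps flip: de)
    show ?thesis
      unfolding 1 2 3 by (simp add: algebra_simps)
  qed
  have "(\<Sum>s\<le>n. t (Suc n) s) - (1 - d * b ^ n) * (\<Sum>s\<le>n. t n s) = (\<Sum>s\<le>n. u (Suc s) - u s)"
    unfolding sum_distrib_left sum_subtractf[symmetric] by (intro sum.cong refl step) simp
  also have "\<dots> = u (Suc n) - u 0"
    unfolding lessThan_Suc_atMost[symmetric] by (rule sum_lessThan_telescope)
  also have "u 0 = 0"
    by (simp add: u_def qpoch_Suc_shift)
  finally have "(\<Sum>s\<le>n. t (Suc n) s) = (1 - d * b ^ n) * (\<Sum>s\<le>n. t n s) + u (Suc n)"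
    by (simp add: algebra_simps)
  moreover have "t (Suc n) (Suc n) = u (Suc n) * b ^ Suc n"
    by (simp add: t_def u_def power_mult_distrib mult_ac)
  ultimately have "(\<Sum>s\<le>Suc n. t (Suc n) s) =
      (1 - d * b ^ n) * (\<Sum>s\<le>n. t n s) + u (Suc n) * (1 + b ^ Suc n)"
    by (simp add: algebra_simps)
  then show ?thesis
    by (simp add: tail_sum_def t_def u_def)
qed

text \<open>All summands with \<open>s > 0\<close> carry the factor \<open>d * b ^ n\<close>.\<close>

lemma tail_sum_cong: "cong_mod (d * b ^ n) (tail_sum d e b n) (qpoch b b n)"
proof -
  have "tail_sum d e b n - qpoch b b n =
        (\<Sum>s<n. qpoch (b ^ Suc (Suc s)) b (n - Suc s) * qpoch e b (Suc s) * (d * b ^ n) ^ Suc s)"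
    unfolding tail_sum_def by (subst sum.atMost_shift) simp
  also have "d * b ^ n dvd \<dots>"
    by (intro dvd_sum) simp
  finally show ?thesis
    by (simp add: cong_mod_def)
qed

text \<open>Each step of the recurrence contributes two new terms of the theta series, because
  \<open>T\<^bsub>2n+1\<^esub> = (2n + 1)(n + 1)\<close> and \<open>T\<^bsub>2n+2\<^esub> = T\<^bsub>2n+1\<^esub> + 2 (n + 1)\<close>.\<close>

lemma triangular_sum_eq_tail_sum:
  fixes q :: "'a::comm_ring_1"
  shows "qpoch q (q\<^sup>2) n * (\<Sum>s\<le>2 * n. q ^ (s * (s + 1) div 2)) = tail_sum q q (q\<^sup>2) n"
proof (induction n)
  case 0
  show ?case by (simp add: tail_sum_def)
next
  case (Suc n)
  define S where "S = (\<Sum>s\<le>2 * n. q ^ (s * (s + 1) div 2))"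
  have e1: "Suc (2 * n) * (Suc (2 * n) + 1) div 2 = (2 * n + 1) * Suc n"
    by simp
  have e2: "Suc (Suc (2 * n)) * (Suc (Suc (2 * n)) + 1) div 2 = (2 * n + 1) * Suc n + 2 * Suc n"
    by (simp add: algebra_simps)
  have sum: "(\<Sum>s\<le>2 * Suc n. q ^ (s * (s + 1) div 2)) =
             S + (q * (q\<^sup>2) ^ n) ^ Suc n * (1 + (q\<^sup>2) ^ Suc n)"
  proof -
    have p: "(q * (q\<^sup>2) ^ n) ^ Suc n = q ^ ((2 * n + 1) * Suc n)"
      by (simp only: power_mult power_add power_one_right mult.commute[of q])
    have "(\<Sum>s\<le>2 * Suc n. q ^ (s * (s + 1) div 2)) =
             S + q ^ ((2 * n + 1) * Suc n) + q ^ ((2 * n + 1) * Suc n + 2 * Suc n)"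
      unfolding S_def mult_Suc_right add_2_eq_Suc sum.atMost_Suc e1 e2 by simp
    also have "\<dots> = S + q ^ ((2 * n + 1) * Suc n) * (1 + (q\<^sup>2) ^ Suc n)"
      unfolding power_add power_mult by (simp add: algebra_simps)
    finally show ?thesis unfolding p .
  qed
  have "tail_sum q q (q\<^sup>2) (Suc n) = (1 - q * (q\<^sup>2) ^ n) * (qpoch q (q\<^sup>2) n * S) +
          qpoch q (q\<^sup>2) (Suc n) * (q * (q\<^sup>2) ^ n) ^ Suc n * (1 + (q\<^sup>2) ^ Suc n)"
    unfolding S_def Suc.IH by (subst tail_sum_Suc) (simp_all add: power2_eq_square)
  also have "\<dots> = qpoch q (q\<^sup>2) (Suc n) * (S + (q * (q\<^sup>2) ^ n) ^ Suc n * (1 + (q\<^sup>2) ^ Suc n))"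
    by (simp only: qpoch_Suc) (simp only: distrib_left mult_ac)
  finally show ?case
    unfolding sum by simp
qed

text \<open>For \<open>e = -1\<close> the product \<open>qpoch e q (Suc n)\<close> starts with the factor \<open>2\<close>, which becomes the
  coefficient of the squares; the factor \<open>1 + q ^ Suc n\<close> of the recurrence is just the one that
  extends \<open>qpoch (- q) q n\<close>.\<close>

lemma square_sum_eq_tail_sum:
  fixes q :: "'a::comm_ring_1"
  shows "qpoch (- q) q n * (1 + 2 * (\<Sum>s=1..n. (- 1) ^ s * q ^ s\<^sup>2)) = tail_sum (- q) (- 1) q n"
proof (induction n)
  case 0
  show ?case by (simp add: tail_sum_def)
next
  case (Suc n)
  define S where "S = 1 + 2 * (\<Sum>s=1..n. (- 1) ^ s * q ^ s\<^sup>2)"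
  have sum: "1 + 2 * (\<Sum>s=1..Suc n. (- 1) ^ s * q ^ s\<^sup>2) = S + 2 * (- q * q ^ n) ^ Suc n"
  proof -
    have "(- q * q ^ n) ^ Suc n = (- (q ^ Suc n)) ^ Suc n" by simp
    also have "\<dots> = (- 1) ^ Suc n * (q ^ Suc n) ^ Suc n" by (rule power_minus)
    also have "(q ^ Suc n) ^ Suc n = q ^ (Suc n)\<^sup>2"
      by (simp only: power2_eq_square power_mult)
    finally show ?thesis by (simp add: S_def algebra_simps)
  qed
  have q': "qpoch (- 1) q (Suc n) = 2 * qpoch (- q) q n"
    by (simp add: qpoch_Suc_shift)
  have "tail_sum (- q) (- 1) q (Suc n) = (1 + q * q ^ n) * (qpoch (- q) q n * S) +
          2 * qpoch (- q) q n * (- q * q ^ n) ^ Suc n * (1 + q ^ Suc n)"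
    unfolding S_def Suc.IH by (subst tail_sum_Suc) (simp_all add: q' del: power_Suc)
  also have "\<dots> = qpoch (- q) q (Suc n) * (S + 2 * (- q * q ^ n) ^ Suc n)"
    by (simp only: qpoch_Suc power_Suc[of q]) (simp add: algebra_simps)
  finally show ?case
    unfolding sum by simp
qed

section \<open>The theorems of Gauss and Euler as congruences\<close>

lemma gauss_triangular_cong:
  fixes q :: "'a::comm_ring_1"
  shows "cong_mod (q ^ Suc (2 * n))
           (qpoch q (q\<^sup>2) n * (\<Sum>s\<le>2 * n. q ^ (s * (s + 1) div 2))) (qpoch (q\<^sup>2) (q\<^sup>2) n)"
  unfolding triangular_sum_eq_tail_sum using tail_sum_cong[of q "q\<^sup>2" n q]
  by (simp add: power_mult)

lemma gauss_square_cong: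
  fixes q :: "'a::comm_ring_1"
  shows "cong_mod (q ^ Suc n)
           (qpoch (- q) q n * (1 + 2 * (\<Sum>s=1..n. (- 1) ^ s * q ^ s\<^sup>2))) (qpoch q q n)"
  unfolding square_sum_eq_tail_sum using tail_sum_cong[of "- q" q n "- 1"]
  by (simp add: cong_mod_def)

text \<open>Truncation at \<open>n\<close> leaves the product of \<open>1 - q\<^sup>k\<close> over \<open>n < k \<le> 2n\<close>. When \<open>n\<close> grows to
  \<open>n + 1\<close>, this range loses \<open>k = n + 1\<close> and gains \<open>2n + 1\<close> and \<open>2n + 2\<close>, and
  \<open>1 - q\<^bsup>2n+2\<^esup> = (1 - q\<^bsup>n+1\<^esup>)(1 + q\<^bsup>n+1\<^esup>)\<close> balances the loss.\<close>

lemma euler_odd_distinct: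
  fixes q :: "'a::comm_ring_1"
  shows "qpoch q (q\<^sup>2) n * qpoch (- q) q n = qpoch (q ^ Suc n) q n"
proof (induction n)
  case (Suc n)
  show ?case
  proof (cases n)
    case 0
    then show ?thesis by (simp add: qpoch_Suc algebra_simps power2_eq_square)
  next
    case (Suc m)
    have "qpoch q (q\<^sup>2) (Suc n) * qpoch (- q) q (Suc n) =
            qpoch (q ^ Suc n) q n * ((1 - q * (q\<^sup>2) ^ n) * (1 + q * q ^ n))"
      unfolding Suc.IH[symmetric] by (simp add: qpoch_Suc mult_ac)
    also have "\<dots> = qpoch (q ^ Suc (Suc n)) q m * (1 - q * (q\<^sup>2) ^ n) * ((1 - q ^ Suc n) * (1 + q ^ Suc n))"
      unfolding Suc qpoch_Suc_shift by (simp add: mult_ac)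
    also have "(1 - q ^ Suc n) * (1 + q ^ Suc n) = 1 - q ^ Suc (Suc n) * q ^ n"
      by (simp add: algebra_simps)
    also have "qpoch (q ^ Suc (Suc n)) q m * (1 - q * (q\<^sup>2) ^ n) = qpoch (q ^ Suc (Suc n)) q n"
      by (simp add: Suc qpoch_Suc power2_eq_square power_mult_distrib mult_ac)
    also have "\<dots> * (1 - q ^ Suc (Suc n) * q ^ n) = qpoch (q ^ Suc (Suc n)) q (Suc n)"
      by (simp only: qpoch_Suc)
    finally show ?thesis .
  qed
qed simp

lemma euler_odd_distinct_cong:
  fixes q :: "'a::comm_ring_1"
  shows "cong_mod (q ^ Suc n) (qpoch q (q\<^sup>2) n * qpoch (- q) q n) 1"
  unfolding euler_odd_distinct by (rule qpoch_cong_1) simp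


section \<open>Products over the admissible parts\<close>

definition distinct_gf :: "nat \<Rightarrow> nat \<Rightarrow> 'a::comm_ring_1 \<Rightarrow> 'a" where
  "distinct_gf k N q = (\<Prod>p\<in>{p\<in>{1..N}. \<not> [p = k] (mod 4)}. 1 + q ^ p)"

lemma distinct_gf_0: "distinct_gf k 0 q = 1"
  by (simp add: distinct_gf_def)

lemma distinct_gf_Suc:
  "distinct_gf k (Suc N) q = (if [Suc N = k] (mod 4) then 1 else 1 + q ^ Suc N) * distinct_gf k N q"
proof -
  have "{p\<in>{1..Suc N}. \<not> [p = k] (mod 4)} =
          (if [Suc N = k] (mod 4) then {} else {Suc N}) \<union> {p\<in>{1..N}. \<not> [p = k] (mod 4)}"
    by (auto simp: le_Suc_eq)
  then show ?thesis
    by (simp add: distinct_gf_def)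
qed

text \<open>The bound \<open>4 * n\<close> lets the induction add one full period of residues modulo 4 at a time.\<close>

lemma distinct_gf_0_eq_qpoch:
  "distinct_gf 0 (4 * n) q = qpoch (- q) (q\<^sup>2) (2 * n) * qpoch (- (q\<^sup>2)) (q ^ 4) n"
proof (induction n)
  case (Suc n)
  have "4 * Suc n = Suc (Suc (Suc (Suc (4 * n))))"
    by simp
  moreover have "[Suc (Suc (4 * n)) = 2] (mod 4)" "[Suc (Suc (Suc (Suc (4 * n)))) = 0] (mod 4)"
    "\<not> [Suc (4 * n) = 0] (mod 4)" "\<not> [Suc (Suc (Suc (4 * n))) = 0] (mod 4)"
    "\<not> [Suc (Suc (4 * n)) = 0] (mod 4)"
    unfolding cong_def by presburger+
  ultimately have "distinct_gf 0 (4 * Suc n) q = (1 + q ^ (4 * n + 3)) * (1 + q ^ (4 * n + 2)) * (1 + q ^ (4 * n + 1)) *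
          distinct_gf 0 (4 * n) q"
    by (simp add: distinct_gf_Suc mult_ac power_add eval_nat_numeral)
  also have "\<dots> = qpoch (- q) (q\<^sup>2) (2 * Suc n) * qpoch (- (q\<^sup>2)) (q ^ 4) (Suc n)"
    unfolding Suc.IH
    by (simp add: qpoch_Suc power_mult[symmetric] power_add[symmetric] mult_ac)
       (simp add: power_add mult_ac eval_nat_numeral)
  finally show ?case .
qed (simp add: distinct_gf_0)

lemma distinct_gf_2_eq_qpoch:
  "distinct_gf 2 (4 * n) q = qpoch (- q) (q\<^sup>2) (2 * n) * qpoch (- (q ^ 4)) (q ^ 4) n"
proof (induction n)
  case (Suc n)
  have "4 * Suc n = Suc (Suc (Suc (Suc (4 * n))))"
    by simp
  moreover have "[Suc (Suc (4 * n)) = 2] (mod 4)" "[Suc (Suc (Suc (Suc (4 * n)))) = 0] (mod 4)"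
    "\<not> [Suc (4 * n) = 2] (mod 4)" "\<not> [Suc (Suc (Suc (4 * n))) = 2] (mod 4)"
    "\<not> [Suc (Suc (Suc (Suc (4 * n)))) = 2] (mod 4)"
    unfolding cong_def by presburger+
  ultimately have "distinct_gf 2 (4 * Suc n) q = (1 + q ^ (4 * n + 4)) * (1 + q ^ (4 * n + 3)) * (1 + q ^ (4 * n + 1)) *
          distinct_gf 2 (4 * n) q"
    by (simp add: distinct_gf_Suc mult_ac power_add eval_nat_numeral)
  also have "\<dots> = qpoch (- q) (q\<^sup>2) (2 * Suc n) * qpoch (- (q ^ 4)) (q ^ 4) (Suc n)"
    unfolding Suc.IH
    by (simp add: qpoch_Suc power_mult[symmetric] power_add[symmetric] mult_ac)
       (simp add: power_add mult_ac eval_nat_numeral)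
  finally show ?case .
qed (simp add: distinct_gf_0)

lemma gauss_triangular_uminus_cong:
  fixes q :: "'a::comm_ring_1"
  shows "cong_mod (q ^ Suc (2 * n))
           (qpoch (- q) (q\<^sup>2) n * (\<Sum>s\<le>2 * n. (- q) ^ (s * (s + 1) div 2))) (qpoch (q\<^sup>2) (q\<^sup>2) n)"
  using gauss_triangular_cong[of "- q" n] by (simp add: cong_mod_def)

section \<open>Multiplying the generating functions by the theta series\<close>

text \<open>The product is \<open>(x; x) (-x; x\<^sup>2) = (x\<^sup>2; x\<^sup>2) (x\<^sup>2; x\<^sup>4)\<close> with \<open>x = q\<^sup>2\<close>. Replacing \<open>(x\<^sup>2; x\<^sup>2)\<close> by
  \<open>(-x\<^sup>2; x\<^sup>2) \<phi>(-x\<^sup>2)\<close> produces the pair that Euler's theorem cancels.\<close>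

lemma triangular_times_distinct_gf_0_cong:
  fixes q :: "'a::comm_ring_1"
  shows "cong_mod (q ^ Suc (4 * n))
           ((\<Sum>s\<le>4 * n. (- q) ^ (s * (s + 1) div 2)) * distinct_gf 0 (4 * n) q)
           (1 + 2 * (\<Sum>s=1..n. (- 1) ^ s * (q ^ 4) ^ s\<^sup>2))"
proof -
  define T where "T = (\<Sum>s\<le>4 * n. (- q) ^ (s * (s + 1) div 2))"
  define S where "S = 1 + 2 * (\<Sum>s=1..n. (- 1) ^ s * (q ^ 4) ^ s\<^sup>2)"
  define x where "x = q\<^sup>2"
  have q4: "q ^ 4 = x\<^sup>2" by (simp add: x_def flip: power_mult)
  have dvd: "q ^ Suc (4 * n) dvd (x\<^sup>2) ^ Suc n"
    unfolding q4[symmetric] power_mult[symmetric] by (rule le_imp_power_dvd) simp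
  have "T * distinct_gf 0 (4 * n) q = (qpoch (- q) x (2 * n) * T) * qpoch (- x) (x\<^sup>2) n"
    unfolding distinct_gf_0_eq_qpoch q4 x_def[symmetric] by (simp add: mult_ac)
  also have "cong_mod (q ^ Suc (4 * n)) \<dots> (qpoch x x (2 * n) * qpoch (- x) (x\<^sup>2) n)"
    using gauss_triangular_uminus_cong[of q "2 * n"]
    by (intro cong_mod_mult) (simp_all add: T_def x_def mult.assoc[symmetric])
  also have "qpoch x x (2 * n) * qpoch (- x) (x\<^sup>2) n = qpoch (x\<^sup>2) (x\<^sup>2) n * (qpoch x (x\<^sup>2) n * qpoch (- x) (x\<^sup>2) n)"
    unfolding qpoch_double[of x x] by (simp add: power2_eq_square mult_ac)
  also have "\<dots> = qpoch (x\<^sup>2) (x\<^sup>2) n * qpoch (x\<^sup>2) ((x\<^sup>2)\<^sup>2) n"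
    by (simp only: qpoch_mult_uminus)
  also have "cong_mod (q ^ Suc (4 * n)) \<dots> ((qpoch (- (x\<^sup>2)) (x\<^sup>2) n * S) * qpoch (x\<^sup>2) ((x\<^sup>2)\<^sup>2) n)"
    using cong_mod_weaken[OF gauss_square_cong[of "x\<^sup>2" n] dvd]
    by (intro cong_mod_mult cong_mod_refl) (auto simp: S_def q4 intro: cong_mod_sym)
  also have "\<dots> = (qpoch (x\<^sup>2) ((x\<^sup>2)\<^sup>2) n * qpoch (- (x\<^sup>2)) (x\<^sup>2) n) * S"
    by (simp only: mult_ac)
  also have "cong_mod (q ^ Suc (4 * n)) \<dots> (1 * S)"
    by (intro cong_mod_mult cong_mod_refl cong_mod_weaken[OF euler_odd_distinct_cong dvd])
  finally show ?thesis
    by (simp only: T_def S_def mult_1_left)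
qed

text \<open>Here \<open>(x\<^sup>2; x\<^sup>2)\<close> is split off from \<open>(x; x)\<close> and read as \<open>(-x; x\<^sup>2) \<psi>(-x)\<close>, so the triangular
  series is used a second time, at \<open>q\<^sup>2\<close>. The cofactor is \<open>(x; x\<^sup>2) (-x; x\<^sup>2) (-x\<^sup>2; x\<^sup>2)\<close>, which
  Euler's theorem reduces to 1.\<close>

lemma triangular_times_distinct_gf_2_cong:
  fixes q :: "'a::comm_ring_1"
  shows "cong_mod (q ^ Suc (4 * n))
           ((\<Sum>s\<le>4 * n. (- q) ^ (s * (s + 1) div 2)) * distinct_gf 2 (4 * n) q)
           (\<Sum>s\<le>2 * n. (- (q\<^sup>2)) ^ (s * (s + 1) div 2))"
proof -
  define T where "T = (\<Sum>s\<le>4 * n. (- q) ^ (s * (s + 1) div 2))"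
  define S where "S = (\<Sum>s\<le>2 * n. (- (q\<^sup>2)) ^ (s * (s + 1) div 2))"
  define x where "x = q\<^sup>2"
  have q4: "q ^ 4 = x\<^sup>2" by (simp add: x_def flip: power_mult)
  have dvd: "q ^ Suc (4 * n) dvd (x\<^sup>2) ^ Suc n"
    unfolding q4[symmetric] power_mult[symmetric] by (rule le_imp_power_dvd) simp
  have dvd': "q ^ Suc (4 * n) dvd x ^ Suc (2 * n)"
    unfolding x_def power_mult[symmetric] by (rule le_imp_power_dvd) simp
  have "T * distinct_gf 2 (4 * n) q = (qpoch (- q) x (2 * n) * T) * qpoch (- (x\<^sup>2)) (x\<^sup>2) n"
    unfolding distinct_gf_2_eq_qpoch q4 x_def[symmetric] by (simp add: mult_ac)
  also have "cong_mod (q ^ Suc (4 * n)) \<dots> (qpoch x x (2 * n) * qpoch (- (x\<^sup>2)) (x\<^sup>2) n)"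
    using gauss_triangular_uminus_cong[of q "2 * n"]
    by (intro cong_mod_mult) (simp_all add: T_def x_def mult.assoc[symmetric])
  also have "qpoch x x (2 * n) * qpoch (- (x\<^sup>2)) (x\<^sup>2) n =
               qpoch (x\<^sup>2) (x\<^sup>2) n * (qpoch x (x\<^sup>2) n * qpoch (- (x\<^sup>2)) (x\<^sup>2) n)"
    unfolding qpoch_double[of x x] by (simp add: power2_eq_square mult_ac)
  also have "cong_mod (q ^ Suc (4 * n)) \<dots>
               ((qpoch (- x) (x\<^sup>2) n * S) * (qpoch x (x\<^sup>2) n * qpoch (- (x\<^sup>2)) (x\<^sup>2) n))"
    using cong_mod_weaken[OF gauss_triangular_uminus_cong[of x n] dvd']
    by (intro cong_mod_mult cong_mod_refl) (auto simp: S_def x_def intro: cong_mod_sym)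
  also have "\<dots> = ((qpoch x (x\<^sup>2) n * qpoch (- x) (x\<^sup>2) n) * qpoch (- (x\<^sup>2)) (x\<^sup>2) n) * S"
    by (simp only: mult_ac)
  also have "\<dots> = (qpoch (x\<^sup>2) ((x\<^sup>2)\<^sup>2) n * qpoch (- (x\<^sup>2)) (x\<^sup>2) n) * S"
    by (simp only: qpoch_mult_uminus)
  also have "cong_mod (q ^ Suc (4 * n)) \<dots> (1 * S)"
    by (intro cong_mod_mult cong_mod_refl cong_mod_weaken[OF euler_odd_distinct_cong dvd])
  finally show ?thesis
    by (simp only: T_def S_def mult_1_left)
qed

section \<open>Reading off coefficients\<close>

text \<open>A partition into distinct parts is determined by its set of parts. A common bound \<open>N\<close> on the
  parts makes a single product serve all \<open>n \<le> N\<close>.\<close>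

lemma Q_eq_card_subsets:
  assumes "n \<le> N"
  shows "Q k (int n) = card {S. S \<subseteq> {p\<in>{1..N}. \<not> [p = k] (mod 4)} \<and> \<Sum>S = n}"
proof -
  define L where "L = {ps. is_partition n ps \<and> distinct ps \<and> (\<forall>p\<in>set ps. \<not> [p = k] (mod 4))}"
  define F where "F = {S. S \<subseteq> {p\<in>{1..N}. \<not> [p = k] (mod 4)} \<and> \<Sum>S = n}"
  have "bij_betw set L F"
  proof (rule bij_betw_byWitness[where f' = "\<lambda>S. rev (sorted_list_of_set S)"])
    show "\<forall>ps\<in>L. rev (sorted_list_of_set (set ps)) = ps"
    proof
      fix ps assume "ps \<in> L"
      then have "sorted (rev ps)" "distinct ps"
        by (auto simp: L_def is_partition_def sorted_wrt_rev)
      then have "sorted_list_of_set (set (rev ps)) = rev ps"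
        by (simp only: sorted_list_of_set_sort_remdups distinct_remdups_id distinct_rev sort_key_id_if_sorted
              sorted_sort_id)
      then show "rev (sorted_list_of_set (set ps)) = ps"
        by simp
    qed
    show "\<forall>S\<in>F. set (rev (sorted_list_of_set S)) = S"
    proof
      fix S assume "S \<in> F"
      then have "finite S" by (auto simp: F_def intro: finite_subset)
      then show "set (rev (sorted_list_of_set S)) = S" by simp
    qed
    show "set ` L \<subseteq> F"
    proof
      fix S assume "S \<in> set ` L"
      then obtain ps where ps: "ps \<in> L" "S = set ps" by blast
      then have sum: "\<Sum>S = n"
        using distinct_sum_list_conv_Sum[of ps] by (simp add: L_def is_partition_def)
      moreover have "p \<le> N" if "p \<in> S" for p
        using member_le_sum[of p S "\<lambda>p. p"] that sum assms ps(2) by simp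
      ultimately show "S \<in> F"
        using ps by (auto simp: F_def L_def is_partition_def Suc_le_eq)
    qed
    show "(\<lambda>S. rev (sorted_list_of_set S)) ` F \<subseteq> L"
    proof
      fix ps assume "ps \<in> (\<lambda>S. rev (sorted_list_of_set S)) ` F"
      then obtain S where S: "S \<in> F" "ps = rev (sorted_list_of_set S)" by blast
      then have fin: "finite S" by (auto simp: F_def intro: finite_subset)
      then have "sum_list ps = \<Sum>S"
        using S(2) by (simp add: distinct_sum_list_conv_Sum)
      with S fin show "ps \<in> L"
        by (auto simp: F_def L_def is_partition_def sorted_wrt_rev)
    qed
  qed
  then show ?thesis
    by (simp add: Q_def L_def F_def bij_betw_same_card)
qed

lemma coeff_distinct_gf:
  assumes "n \<le> N"
  shows "coeff (distinct_gf k N (monom 1 1)) n = int (Q k (int n))"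
proof -
  define K where "K = {p\<in>{1..N}. \<not> [p = k] (mod 4)}"
  have fin: "finite (Pow K)" by (simp add: K_def)
  have "distinct_gf k N (monom 1 1 :: int poly) = (\<Prod>p\<in>K. monom 1 p + 1)"
    by (simp add: distinct_gf_def K_def monom_power add.commute)
  also have "\<dots> = (\<Sum>S\<in>Pow K. \<Prod>p\<in>S. monom 1 p)"
    by (subst prod_add) (simp_all add: K_def)
  also have "\<dots> = (\<Sum>S\<in>Pow K. monom 1 (\<Sum>S))"
  proof (rule sum.cong[OF refl])
    fix S assume "S \<in> Pow K"
    then have "finite S" by (auto simp: K_def intro: finite_subset)
    then show "(\<Prod>p\<in>S. monom 1 p) = (monom 1 (\<Sum>S) :: int poly)"
      by (induction S) (simp_all add: mult_monom)
  qed
  finally have "coeff (distinct_gf k N (monom 1 1)) n = (\<Sum>S\<in>Pow K. if \<Sum>S = n then 1 else (0::int))"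
    by (simp add: coeff_sum)
  also have "\<dots> = int (card {S\<in>Pow K. \<Sum>S = n})"
    using fin by (simp add: sum.If_cases Int_def)
  finally show ?thesis
    using Q_eq_card_subsets[OF assms, of k] by (simp add: K_def)
qed

lemma uminus_monom_1_power: "(- monom 1 k) ^ n = (monom ((- 1) ^ n) (k * n) :: int poly)"
  by (simp add: minus_monom monom_power)

text \<open>Terms with \<open>k > 4 * n\<close> vanish, as \<open>k \<le> k * (k + 1) div 2\<close>, so the sum is the coefficient
  of \<open>q\<^sup>n\<close> in a product of two polynomials. The modulus \<open>q\<^bsup>4n+1\<^esup>\<close> keeps this coefficient.\<close>

lemma triangular_Q_sums:
  fixes f :: "int poly"
  assumes "cong_mod (monom 1 1 ^ Suc (4 * n))
             ((\<Sum>s\<le>4 * n. (- monom 1 1) ^ (s * (s + 1) div 2)) * distinct_gf r (4 * n) (monom 1 1)) f"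
  shows "(\<lambda>k. (- 1) ^ (k * (k + 1) div 2) * int (Q r (int n - int (k * (k + 1) div 2)))) sums coeff f n"
proof -
  define T where "T k = k * (k + 1) div 2" for k :: nat
  define G where "G = distinct_gf r (4 * n) (monom 1 1 :: int poly)"
  have le_T: "k \<le> T k" for k
    by (cases k) (auto simp: T_def)
  have Q_neg: "Q r (int n - int (T k)) = 0" if "k \<notin> {..4 * n}" for k
    using that le_T[of k] by (simp add: Q_def)
  have "coeff f n = coeff ((\<Sum>s\<le>4 * n. (- monom 1 1) ^ T s) * G) n"
    using assms by (simp add: cong_mod_def T_def G_def monom_power monom_1_dvd_iff' del: power_Suc)
  also have "\<dots> = (\<Sum>s\<le>4 * n. coeff (monom ((- 1) ^ T s) (T s) * G) n)"
    by (simp add: sum_distrib_right coeff_sum uminus_monom_1_power)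
  also have "\<dots> = (\<Sum>s\<le>4 * n. (- 1) ^ T s * int (Q r (int n - int (T s))))"
  proof (rule sum.cong[OF refl])
    fix s
    show "coeff (monom ((- 1) ^ T s) (T s) * G) n = (- 1) ^ T s * int (Q r (int n - int (T s)))"
    proof (cases "n < T s")
      case True
      then show ?thesis by (simp add: coeff_monom_mult Q_def)
    next
      case False
      then have "coeff G (n - T s) = int (Q r (int (n - T s)))"
        unfolding G_def by (intro coeff_distinct_gf) simp
      with False show ?thesis
        by (simp add: coeff_monom_mult of_nat_diff)
    qed
  qed
  finally have "coeff f n = (\<Sum>s\<le>4 * n. (- 1) ^ T s * int (Q r (int n - int (T s))))" .
  then show ?thesis
    using sums_finite[of "{..4 * n}" "\<lambda>k. (- 1) ^ T k * int (Q r (int n - int (T k)))"] Q_neg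
    by (simp add: T_def)
qed

lemma coeff_square_sum_eq_xi:
  "coeff (1 + 2 * (\<Sum>s=1..n. (- 1) ^ s * (monom 1 1 ^ 4) ^ s\<^sup>2)) n = xi n"
proof -
  have "(- 1) ^ s * (monom 1 1 ^ 4) ^ s\<^sup>2 = (monom ((- 1) ^ s) (4 * s\<^sup>2) :: int poly)" for s
    by (cases "even s") (simp_all add: monom_power minus_monom)
  then have c: "coeff (1 + 2 * (\<Sum>s=1..n. (- 1) ^ s * (monom 1 1 ^ 4) ^ s\<^sup>2)) n =
      (if n = 0 then 1 else 0) + 2 * (\<Sum>s=1..n. if n = 4 * s\<^sup>2 then (- 1) ^ s else (0::int))"
    by (simp add: coeff_sum numeral_poly eq_commute[of _ n])
  show ?thesis
  proof (cases "\<exists>m::nat. m > 0 \<and> n = 4 * m\<^sup>2")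
    case True
    then obtain m :: nat where m: "m > 0" "n = 4 * m\<^sup>2" by blast
    then have uniq: "n = 4 * s\<^sup>2 \<longleftrightarrow> s = m" for s :: nat
      by auto
    have "m \<le> n" using m by (simp add: power2_eq_square)
    then have "(\<Sum>s=1..n. if n = 4 * s\<^sup>2 then (- 1) ^ s else (0::int)) = (- 1) ^ m"
      using m(1) unfolding uniq by simp
    moreover have "xi n = (- 1) ^ m * 2"
    proof -
      have "(THE s. s > 0 \<and> n = 4 * s\<^sup>2) = m"
        using m(1) unfolding uniq by blast
      then show ?thesis using True by (simp add: xi_def)
    qed
    ultimately show ?thesis using c m by simp
  next
    case False
    then have "n \<noteq> 4 * s\<^sup>2" if "s \<in> {1..n}" for s
      using that by (metis atLeastAtMost_iff less_le_trans zero_less_one)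
    then have "(\<Sum>s=1..n. if n = 4 * s\<^sup>2 then (- 1) ^ s else (0::int)) = 0"
      by (intro sum.neutral) simp
    with False c show ?thesis unfolding xi_def by simp
  qed
qed

lemma coeff_triangular_sum_eq_chi:
  "coeff (\<Sum>s\<le>2 * n. (- (monom 1 1)\<^sup>2) ^ (s * (s + 1) div 2)) n = chi n"
proof -
  have "2 * (s * (s + 1) div 2) = s * (s + 1)" for s :: nat
    by simp
  then have c: "coeff (\<Sum>s\<le>2 * n. (- (monom 1 1)\<^sup>2) ^ (s * (s + 1) div 2)) n =
      (\<Sum>s\<le>2 * n. if n = s * (s + 1) then (- 1) ^ (n div 2) else (0::int))"
    unfolding coeff_sum monom_power by (intro sum.cong) (auto simp: uminus_monom_1_power)
  show ?thesis
  proof (cases "\<exists>m::nat. n = m * (m + 1)")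
    case True
    then obtain m :: nat where m: "n = m * (m + 1)" by blast
    have uniq: "n = s * (s + 1) \<longleftrightarrow> s = m" for s :: nat
    proof
      assume "n = s * (s + 1)"
      then have "s * (s + 1) = m * (m + 1)" using m by simp
      then show "s = m"
        using mult_strict_mono[of s m "s + 1" "m + 1"] mult_strict_mono[of m s "m + 1" "s + 1"]
        by (cases s m rule: linorder_cases) auto
    qed (use m in simp)
    have "m \<le> 2 * n" using m by simp
    then show ?thesis
      using c True unfolding uniq chi_def by simp
  next
    case False
    then show ?thesis using c unfolding chi_def by simp
  qed
qed

theorem theorem1p4:
  fixes n :: nat
  shows "((\<lambda>k::nat. (-1) ^ (k * (k + 1) div 2) * int (Q 0 (int n - int (k * (k + 1) div 2)))) sums xi n) \<and>
         ((\<lambda>k::nat. (-1) ^ (k * (k + 1) div 2) * int (Q 2 (int n - int (k * (k + 1) div 2)))) sums chi n)"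
  using triangular_Q_sums[OF triangular_times_distinct_gf_0_cong, of n]
    triangular_Q_sums[OF triangular_times_distinct_gf_2_cong, of n]
  unfolding coeff_square_sum_eq_xi coeff_triangular_sum_eq_chi by blast

end
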